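(* All equilibria of the axisymmetric surface diffusion problem (ASD) fall into the family of undulary curves: if $\bar r$ is an equilibrium of (ASD), then, up to a translation along the $x$-axis, the graph of (the $2\pi$-periodic extension of) $\bar r$ is a curve $R(\mathcal{H},B)$ with $\mathcal{H}>0$ and $0\le|B|<1$ (where $B=0$ corresponds to the constant function $1/\mathcal{H}$, i.e. the cylinder of radius $1/\mathcal{H}$).
   Context: Problem (ASD): for a positive function $r=r(t,x)$, $2\pi$-periodic in $x$ (i.e. $x\in\mathbb{T}=[-\pi,\pi]$ with endpoints identified), $$r_t=G(r):=\frac1r\,\partial_x\Big[\frac{r}{\sqrt{1+r_x^2}}\,\partial_x\mathcal{H}(r)\Big]\ (t>0),\qquad r(0,\cdot)=r_0,\qquad \mathcal{H}(r)=\frac{1}{r\sqrt{1+r_x^2}}-\frac{r_{xx}}{(1+r_x^2)^{3/2}}.$$ Fix $\alpha\in(0,1)$. An equilibrium of (ASD) is a positive function $\bar r\in h^{2+\alpha}(\mathbb{T})$ whose maximal solution $r(\cdot,\bar r)$ of (ASD) satisfies $r(t,\bar r)=\bar r$ for all $t>0$; equivalently, a positive $\bar r\in h^{4+\alpha}(\mathbb{T})$ with $G(\bar r)=0$. Here $h^{k+\alpha}(\mathbb{T})$ is the little-Hölder space of those $f\in C^{k+\alpha}(\mathbb{T})$ with $\lim_{\delta\to0}\sup_{0<d(x,y)<\delta}|f^{(k)}(x)-f^{(k)}(y)|/d(x,y)^\alpha=0$, $d$ being the metric of the circle. For $\mathcal{H}\neq0$ and $B\in\mathbb{R}$, $R(\mathcal{H},B)\subset\mathbb{R}^2$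 denotes the curve parametrized by arc length $s\in\mathbb{R}$, $$R(s;\mathcal{H},B)=\Bigg(\int_{\pi/2\mathcal{H}}^{s}\frac{1+B\sin(\mathcal{H}t)}{\sqrt{1+B^2+2B\sin(\mathcal{H}t)}}\,dt,\ \frac{\sqrt{1+B^2+2B\sin(\mathcal{H}s)}}{|\mathcal{H}|}\Bigg).$$ For $0\le|B|<1$ the curves $R(\mathcal{H},B)$ are called undulary curves; they are graphs of strictly positive functions over the $x$-axis. *)

theory Defs
  imports "HOL-Analysis.Analysis"
begin

text \<open>Functions on the circle \<open>\<real> / 2\<pi>\<int>\<close> are represented by their \<open>2\<pi>\<close>-periodic extensions to the
  real line.\<close>

definition circle_dist :: "real \<Rightarrow> real \<Rightarrow> real" where
  "circle_dist x y = (INF n::int. \<bar>x - y + 2 * pi * of_int n\<bar>)"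

definition Ck_circle :: "nat \<Rightarrow> (real \<Rightarrow> real) set" where
  "Ck_circle k = {f. (\<forall>x. f (x + 2 * pi) = f x) \<and>
     (\<forall>j<k. \<forall>x. (deriv ^^ j) f differentiable (at x)) \<and>
     continuous_on UNIV ((deriv ^^ k) f)}"

definition holder_circle :: "nat \<Rightarrow> real \<Rightarrow> (real \<Rightarrow> real) set" where
  "holder_circle k \<alpha> = {f \<in> Ck_circle k.
     bdd_above {\<bar>(deriv ^^ k) f x - (deriv ^^ k) f y\<bar> / circle_dist x y powr \<alpha> | x y.
       0 < circle_dist x y}}"

text \<open>The suprema below are taken in \<open>\<real>\<close>; they are bounded because \<open>f\<close> belongs to the Hoelder
  space, and the underlying sets are nonempty for \<open>\<delta> > 0\<close>.\<close>

definition little_holder_circle :: "nat \<Rightarrow> real \<Rightarrow> (real \<Rightarrow> real) set" where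
  "little_holder_circle k \<alpha> = {f \<in> holder_circle k \<alpha>.
     ((\<lambda>\<delta>. Sup {\<bar>(deriv ^^ k) f x - (deriv ^^ k) f y\<bar> / circle_dist x y powr \<alpha> | x y.
         0 < circle_dist x y \<and> circle_dist x y < \<delta>}) \<longlongrightarrow> 0) (at_right 0)}"

definition mean_curv :: "(real \<Rightarrow> real) \<Rightarrow> real \<Rightarrow> real" where
  "mean_curv r x = 1 / (r x * sqrt (1 + (deriv r x)\<^sup>2))
     - deriv (deriv r) x / (1 + (deriv r x)\<^sup>2) powr (3/2)"

definition ASD_op :: "(real \<Rightarrow> real) \<Rightarrow> real \<Rightarrow> real" where
  "ASD_op r x = 1 / r x *
     deriv (\<lambda>y. r y / sqrt (1 + (deriv r y)\<^sup>2) * deriv (mean_curv r) y) x"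

definition ASD_equilibrium :: "real \<Rightarrow> (real \<Rightarrow> real) \<Rightarrow> bool" where
  "ASD_equilibrium \<alpha> r \<longleftrightarrow>
     r \<in> little_holder_circle 4 \<alpha> \<and> (\<forall>x. 0 < r x) \<and> (\<forall>x. ASD_op r x = 0)"

text \<open>The interval integral is oriented, so the parametrization is meaningful for all real \<open>s\<close>.\<close>

definition delaunay_param :: "real \<Rightarrow> real \<Rightarrow> real \<Rightarrow> real \<times> real" where
  "delaunay_param H B s =
     (LBINT t=ereal (pi / (2 * H))..ereal s.
        (1 + B * sin (H * t)) / sqrt (1 + B\<^sup>2 + 2 * B * sin (H * t)),
      sqrt (1 + B\<^sup>2 + 2 * B * sin (H * s)) / \<bar>H\<bar>)"

definition delaunay_curve :: "real \<Rightarrow> real \<Rightarrow> (real \<times> real) set" where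
  "delaunay_curve H B = range (delaunay_param H B)"

definition graph_of :: "(real \<Rightarrow> real) \<Rightarrow> (real \<times> real) set" where
  "graph_of f = {(x, f x) | x. True}"

definition translate_x :: "real \<Rightarrow> (real \<times> real) set \<Rightarrow> (real \<times> real) set" where
  "translate_x c S = (\<lambda>(x, y). (x + c, y)) ` S"

end

theory Submission imports Defs begin

text \<open>For an equilibrium the flux \<open>r \<partial>\<^sub>xH(r) / \<surd>(1 + r\<^sub>x\<^sup>2)\<close> is constant. Periodicity of the mean curvature makes
  its derivative vanish somewhere, so the flux is zero and the mean curvature is a constant \<open>H\<close>; it is
  positive by its value at a maximum of \<open>r\<close>. Then \<open>2r / \<surd>(1 + r\<^sub>x\<^sup>2) - H r\<^sup>2\<close> is constant, and as a
  function of arc length \<open>r\<^sup>2\<close> satisfies the linear equation \<open>u'' = - H\<^sup>2 u + 1 + B\<^sup>2\<close> with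
  \<open>B = H max r - 1\<close>. Hence \<open>H\<^sup>2r\<^sup>2 = 1 + B\<^sup>2 + 2B sin(Hs)\<close> once arc length is normalised to
  \<open>\<pi>/(2H)\<close> at the maximum.\<close>

section \<open>Calculus for periodic functions, maxima and oriented integrals\<close>

lemma deriv_periodic:
  fixes f :: "real \<Rightarrow> real"
  assumes "\<And>x. f (x + a) = f x"
  shows "deriv f (x + a) = deriv f x"
  using assms by (simp add: deriv_def DERIV_shift)

lemma periodic_attains_max:
  fixes f :: "real \<Rightarrow> real"
  assumes "0 < a" and per: "\<And>x. f (x + a) = f x" and cont: "continuous_on UNIV f"
  obtains m where "\<And>x. f x \<le> f m"
proof -
  interpret periodic_fun_simple f a by unfold_locales (rule per)
  have "continuous_on {0..a} f" using cont continuous_on_subset by blast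
  then obtain m where m: "\<And>y. y \<in> {0..a} \<Longrightarrow> f y \<le> f m"
    using continuous_attains_sup[of "{0..a}" f] \<open>0 < a\<close>
    by (metis atLeastAtMost_iff compact_Icc empty_iff less_eq_real_def order_refl)
  have "f x \<le> f m" for x
  proof -
    have "of_int \<lfloor>x / a\<rfloor> * a \<le> x" "x \<le> (of_int \<lfloor>x / a\<rfloor> + 1) * a"
      using \<open>0 < a\<close> floor_divide_lower[of a x] floor_divide_upper[of a x] by auto
    then have "f (x - of_int \<lfloor>x / a\<rfloor> * a) \<le> f m"
      by (intro m) (auto simp: algebra_simps)
    then show ?thesis by (simp add: minus_of_int)
  qed
  then show thesis by (rule that)
qed

text \<open>If \<open>c\<close> were positive, \<open>f'\<close> would be positive just to the right
  of its zero \<open>m\<close>, and the mean value theorem would push \<open>f\<close> above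
  \<open>f m\<close>.\<close>

lemma global_max_deriv_conditions:
  fixes f f' :: "real \<Rightarrow> real"
  assumes f: "\<And>x. (f has_real_derivative f' x) (at x)"
    and f': "(f' has_real_derivative c) (at m)"
    and max: "\<And>x. f x \<le> f m"
  shows "f' m = 0" and "c \<le> 0"
proof -
  show zero: "f' m = 0"
    using DERIV_local_max[OF f zero_less_one] max by blast
  show "c \<le> 0"
  proof (rule ccontr)
    assume "\<not> c \<le> 0"
    then obtain d where "0 < d" and d: "\<And>h. 0 < h \<Longrightarrow> h < d \<Longrightarrow> f' m < f' (m + h)"
      using DERIV_pos_inc_right[OF f'] by auto
    obtain z where z: "m < z" "z < m + d / 2" "f (m + d / 2) - f m = (m + d / 2 - m) * f' z"
      using MVT2[of m "m + d / 2" f f'] f \<open>0 < d\<close> by auto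
    have "0 < f' z" using d[of "z - m"] z \<open>0 < d\<close> zero by auto
    then have "f m < f (m + d / 2)" using z(3) \<open>0 < d\<close>
      by (smt (verit) mult_pos_pos field_sum_of_halves)
    then show False using max[of "m + d / 2"] by simp
  qed
qed

lemma interval_integral_has_real_derivative:
  fixes f :: "real \<Rightarrow> real"
  assumes "continuous_on UNIV f"
  shows "((\<lambda>u. LBINT t=ereal a..ereal u. f t) has_real_derivative f x) (at x)"
proof -
  \<comment> \<open>The margin of 1 keeps \<open>x\<close> in the interior, on whichever side of
    \<open>a\<close> it lies, so the one-sided conclusion of the FTC becomes two-sided.\<close>
  define lo hi where "lo = min a x - 1" and "hi = max a x + 1"
  have "continuous_on {lo..hi} f" using assms continuous_on_subset by blast
  then have "((\<lambda>u. LBINT t=ereal a..ereal u. f t) has_vector_derivative f x) (at x within {lo..hi})"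
    by (intro interval_integral_FTC2) (auto simp: lo_def hi_def)
  moreover have "x \<in> interior {lo..hi}"
    by (auto simp: lo_def hi_def)
  ultimately show ?thesis
    by (simp only: at_within_interior has_real_derivative_iff_has_vector_derivative)
qed

lemma has_real_derivative_sqrt_one_plus_square:
  fixes f :: "real \<Rightarrow> real"
  assumes "(f has_real_derivative d) (at x)"
  shows "((\<lambda>x. sqrt (1 + (f x)\<^sup>2)) has_real_derivative f x * d / sqrt (1 + (f x)\<^sup>2)) (at x)"
proof -
  have "0 < 1 + (f x)\<^sup>2" by (simp add: add_pos_nonneg)
  then show ?thesis
    by (auto intro!: derivative_eq_intros assms simp: field_simps)
qed

text \<open>\<open>S x - x\<close> is nondecreasing, so \<open>S\<close> is unbounded both ways.
  This is what lets arc length reach every parameter of the Delaunay curve.\<close>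

lemma surj_of_deriv_ge_one:
  fixes S w :: "real \<Rightarrow> real"
  assumes S: "\<And>x. (S has_real_derivative w x) (at x)" and w: "\<And>x. 1 \<le> w x"
  shows "surj S"
proof -
  have mono: "S a - a \<le> S b - b" if "a \<le> b" for a b
    by (rule DERIV_nonneg_imp_nondecreasing[OF that, of "\<lambda>x. S x - x"])
      (use w in \<open>auto intro!: exI derivative_eq_intros S\<close>)
  have cont: "continuous_on A S" for A
    using S by (meson DERIV_continuous_on has_field_derivative_at_within)
  have "\<exists>x. S x = y" for y
  proof -
    define d where "d = \<bar>y - S 0\<bar>"
    have "S (- d) \<le> y" "y \<le> S d"
      using mono[of "-d" 0] mono[of 0 d] by (auto simp: d_def)
    then show ?thesis
      using IVT'[of S "-d" y d] cont by (auto simp: d_def)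
  qed
  then show ?thesis by (metis surjI)
qed

section \<open>From (ASD) to constant mean curvature\<close>

lemma equilibrium_constant_mean_curv:
  assumes "ASD_equilibrium \<alpha> r"
  obtains p q H where
    "\<And>x. (r has_real_derivative p x) (at x)"
    "\<And>x. (p has_real_derivative q x) (at x)"
    "\<And>x. 1 / (r x * sqrt (1 + (p x)\<^sup>2)) - q x / sqrt (1 + (p x)\<^sup>2) ^ 3 = H"
proof -
  define p q t where "p = deriv r" and "q = deriv p" and "t = deriv q"
  define w where "w x = sqrt (1 + (p x)\<^sup>2)" for x
  have per: "r (x + 2 * pi) = r x" and pos: "0 < r x" and G: "ASD_op r x = 0"
    and dj: "j < 4 \<Longrightarrow> (deriv ^^ j) r differentiable (at x)" for x j
    using assms
    by (auto simp: ASD_equilibrium_def little_holder_circle_def holder_circle_def Ck_circle_def)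
  have r: "(r has_real_derivative p x) (at x)"
    and p: "(p has_real_derivative q x) (at x)"
    and q: "(q has_real_derivative t x) (at x)"
    and t: "t differentiable (at x)" for x
    using dj[of 0 x] dj[of 1 x] dj[of 2 x] dj[of 3 x]
    by (auto simp: p_def q_def t_def eval_nat_numeral DERIV_deriv_iff_real_differentiable)
  have w_pos: "0 < w x" for x
    by (simp add: w_def add_pos_nonneg)
  have w: "(w has_real_derivative p x * q x / w x) (at x)" for x
    unfolding w_def using p by (rule has_real_derivative_sqrt_one_plus_square)
  have curv: "mean_curv r = (\<lambda>x. 1 / (r x * w x) - q x / w x ^ 3)"
  proof
    fix x
    have "(1 + (p x)\<^sup>2) powr (3/2) = w x ^ 3"
      using powr_realpow[OF w_pos[of x], of 3]
      by (simp add: w_def powr_half_sqrt[symmetric] powr_powr)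
    then show "mean_curv r x = 1 / (r x * w x) - q x / w x ^ 3"
      by (simp add: mean_curv_def w_def p_def q_def)
  qed
  \<comment> \<open>Left unsimplified: this is literally the term that the quotient and product
    rules produce.\<close>
  define K where "K x =
      (0 * (r x * w x) - 1 * (p x * w x + p x * q x / w x * r x)) / (r x * w x * (r x * w x))
      - (t x * w x ^ 3 - q x * (real 3 * (p x * q x / w x * w x ^ 2))) / (w x ^ 3 * w x ^ 3)" for x
  have K: "(mean_curv r has_real_derivative K x) (at x)" for x
  proof -
    have "((\<lambda>x. w x ^ 3) has_real_derivative real 3 * (p x * q x / w x * w x ^ 2)) (at x)"
      using DERIV_power[OF w, of 3] by simp
    then show ?thesis
      unfolding curv K_def using pos[of x] w_pos[of x]
      by (intro DERIV_diff DERIV_divide DERIV_mult DERIV_const r w q) auto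
  qed
  have dK: "deriv (mean_curv r) = K"
    using K by (auto intro!: DERIV_imp_deriv)
  have diff: "r differentiable (at x)" "p differentiable (at x)" "q differentiable (at x)"
    "w differentiable (at x)" for x
    using r p q w real_differentiable_def by blast+
  have K_diff: "K differentiable (at x)" for x
    unfolding K_def using pos[of x] w_pos[of x]
    by (intro derivative_intros diff t) auto
  define F where "F y = r y / w y * K y" for y
  have F: "(F has_real_derivative 0) (at x)" for x
  proof -
    have "F differentiable (at x)"
      unfolding F_def using w_pos[of x] by (intro derivative_intros diff K_diff) auto
    moreover have "deriv F x = 0"
    proof -
      have "1 / r x * deriv F x = 0"
        using G[of x] by (simp only: ASD_op_def dK F_def[abs_def] p_def w_def)
      then show ?thesis using pos[of x] by simp
    qed
    ultimately show ?thesis by (metis DERIV_deriv_iff_real_differentiable)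
  qed
  \<comment> \<open>Rolle's theorem over one period.\<close>
  obtain z where "K z = 0"
  proof -
    have "p (x + 2 * pi) = p x" for x
      using deriv_periodic per by (simp add: p_def)
    moreover from this have "q (x + 2 * pi) = q x" for x
      using deriv_periodic by (simp add: q_def)
    ultimately have "mean_curv r (0 + 2 * pi) = mean_curv r 0"
      by (simp only: curv w_def per)
    moreover obtain z where "mean_curv r (2 * pi) - mean_curv r 0 = (2 * pi - 0) * K z"
      using MVT2[of 0 "2 * pi" "mean_curv r" K] K by auto
    ultimately show thesis using that by simp
  qed
  then have "F x = 0" for x
    using DERIV_isconst_all[of F x z] F by (simp add: F_def)
  then have "K x = 0" for x
    using pos[of x] w_pos[of x] by (simp add: F_def) (metis less_irrefl)
  then have "mean_curv r x = mean_curv r 0" for x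
    using DERIV_isconst_all[of "mean_curv r" x 0] K by simp
  then show thesis
    using that[OF r p, of "mean_curv r 0"] by (simp add: curv w_def)
qed

section \<open>Integration of the constant mean curvature equation\<close>

theorem mainTheorem3:
  fixes \<alpha> :: real and r :: "real \<Rightarrow> real"
  assumes "0 < \<alpha>" and "\<alpha> < 1"
    and "ASD_equilibrium \<alpha> r"
  shows "\<exists>H B c :: real. 0 < H \<and> 0 \<le> \<bar>B\<bar> \<and> \<bar>B\<bar> < 1 \<and>
    translate_x c (graph_of r) = delaunay_curve H B \<and>
    (B = 0 \<longleftrightarrow> (\<forall>x. r x = 1 / H))"
proof -
  obtain p q H where
    r: "\<And>x. (r has_real_derivative p x) (at x)" and
    p: "\<And>x. (p has_real_derivative q x) (at x)" and
    curv: "\<And>x. 1 / (r x * sqrt (1 + (p x)\<^sup>2)) - q x / sqrt (1 + (p x)\<^sup>2) ^ 3 = H"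
    using equilibrium_constant_mean_curv[OF assms(3)] by blast
  have per: "r (x + 2 * pi) = r x" and pos: "0 < r x" for x
    using assms(3)
    by (auto simp: ASD_equilibrium_def little_holder_circle_def holder_circle_def Ck_circle_def)
  define w where "w x = sqrt (1 + (p x)\<^sup>2)" for x
  have w_sq: "(w x)\<^sup>2 = 1 + (p x)\<^sup>2" and w_ge: "1 \<le> w x" for x
    by (auto simp: w_def)
  have w_pos: "0 < w x" for x using w_ge[of x] by simp
  have w: "(w has_real_derivative p x * q x / w x) (at x)" for x
    unfolding w_def using p by (rule has_real_derivative_sqrt_one_plus_square)
  have q_eq: "q x = (w x)\<^sup>2 / r x - H * w x ^ 3" for x
    using curv[of x] pos[of x] w_pos[of x] unfolding w_def[symmetric]
    by (auto simp: field_simps power2_eq_square power3_eq_cube)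
  have cont_r: "continuous_on UNIV r" and cont_w: "continuous_on UNIV w"
    by (rule DERIV_continuous_on, rule r) (rule DERIV_continuous_on, rule w)

  obtain x0 where x0: "\<And>x. r x \<le> r x0"
    using periodic_attains_max[OF _ per cont_r] by auto
  obtain x1 where x1: "\<And>x. - r x \<le> - r x1"
    using periodic_attains_max[of "2 * pi" "\<lambda>x. - r x"] per cont_r
    by (auto intro!: continuous_intros)
  have p_x0: "p x0 = 0" and "q x0 \<le> 0"
    using global_max_deriv_conditions[OF r p x0] by auto
  have neg: "((\<lambda>x. - r x) has_real_derivative - p x) (at x)"
    "((\<lambda>x. - p x) has_real_derivative - q x) (at x)" for x
    by (auto intro!: derivative_eq_intros r p)
  have p_x1: "p x1 = 0" and "0 \<le> q x1"
    using global_max_deriv_conditions[OF neg x1] by auto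
  have w_x0: "w x0 = 1" and w_x1: "w x1 = 1" using p_x0 p_x1 by (auto simp: w_def)
  \<comment> \<open>Where \<open>w = 1\<close> the equation reads \<open>q = 1 / r - H\<close>, so
    the sign of \<open>q\<close> at an extremum compares \<open>H * r\<close> with 1.\<close>
  have Hx0: "1 \<le> H * r x0" and Hx1: "H * r x1 \<le> 1"
    using q_eq[of x0] q_eq[of x1] w_x0 w_x1 pos[of x0] pos[of x1]
      mult_nonpos_nonneg[OF \<open>q x0 \<le> 0\<close>, of "r x0"] mult_nonneg_nonneg[OF \<open>0 \<le> q x1\<close>, of "r x1"]
    by (auto simp: field_simps)
  have H_pos: "0 < H"
    using Hx0 pos[of x0] by (smt (verit) mult_nonpos_nonneg)
  \<comment> \<open>The greatest height of the undulary curve for \<open>B \<ge> 0\<close> is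
    \<open>(1 + B) / H\<close>; it is matched to \<open>r x0\<close>.\<close>
  define B where "B = H * r x0 - 1"

  \<comment> \<open>The classical first integral of the constant mean curvature equation.\<close>
  define E where "E x = 2 * r x / w x - H * (r x)\<^sup>2" for x
  have "(E has_real_derivative 0) (at x)" for x
    unfolding E_def using pos[of x] w_pos[of x]
    by (auto intro!: derivative_eq_intros r w)
      (simp add: q_eq field_simps power2_eq_square power3_eq_cube)
  then have E_const: "E x = E x0" for x
    using DERIV_isconst_all by blast
  have E_x0: "H * E x0 = 1 - B\<^sup>2"
    using w_x0 by (simp add: E_def B_def power2_eq_square algebra_simps)
  have first_integral: "2 * (H * r x) / w x = (H * r x)\<^sup>2 + 1 - B\<^sup>2" for x
    using E_x0 unfolding E_const[of x, symmetric]
    by (simp add: E_def power2_eq_square algebra_simps)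
  \<comment> \<open>Evaluated at the minimum \<open>x1\<close> instead, where
    \<open>2 - H * r x1 \<ge> 1\<close>.\<close>
  have "0 < H * E x0"
  proof -
    have "E x0 = r x1 * (2 - H * r x1)"
      unfolding E_const[of x1, symmetric] using w_x1
      by (simp add: E_def power2_eq_square algebra_simps)
    then show ?thesis using Hx1 pos[of x1] H_pos by simp
  qed
  then have B_lt: "\<bar>B\<bar> < 1"
    using E_x0 by (simp add: abs_square_less_1)

  \<comment> \<open>Arc length, with the offset that puts the maximum of \<open>r\<close> where the
    sine is 1, which is also the lower limit of the integral in
    \<open>delaunay_param\<close>.\<close>
  define S where "S x = pi / (2 * H) + (LBINT t=ereal x0..ereal x. w t)" for x
  have S: "(S has_real_derivative w x) (at x)" for x
    unfolding S_def
    by (auto intro!: derivative_eq_intros interval_integral_has_real_derivative cont_w)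
  have HS_x0: "H * S x0 = pi / 2" using H_pos by (simp add: S_def)

  \<comment> \<open>In arc length, \<open>r\<^sup>2\<close> solves a linear oscillator equation. The pair \<open>(v, z)\<close> is its deviation
    from the solution with the same data at \<open>x0\<close>, and vanishes since its energy is conserved.\<close>
  define v where "v x = (H * r x)\<^sup>2 - (1 + B\<^sup>2) - 2 * B * sin (H * S x)" for x
  define z where "z x = 2 * H * (r x * p x / w x) - 2 * B * cos (H * S x)" for x
  have v': "(v has_real_derivative H * w x * z x) (at x)" for x
    unfolding v_def z_def using w_pos[of x]
    by (auto intro!: derivative_eq_intros r S simp: field_simps power2_eq_square)
  have z': "(z has_real_derivative - (H * w x * v x)) (at x)" for x
  proof -
    \<comment> \<open>\<open>r * p / w\<close> is half the arc length derivative of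
      \<open>r\<^sup>2\<close>.\<close>
    have "((\<lambda>x. r x * p x / w x) has_real_derivative
        ((p x * p x + r x * q x) * w x - r x * p x * (p x * q x / w x)) / (w x * w x)) (at x)"
      using w_pos[of x] by (auto intro!: derivative_eq_intros r p w simp: algebra_simps)
    moreover have "((p x * p x + r x * q x) * w x - r x * p x * (p x * q x / w x)) / (w x * w x)
        = w x - H * r x"
    proof -
      have "((p x * p x + r x * q x) * w x - r x * p x * (p x * q x / w x)) / (w x * w x)
          = ((p x)\<^sup>2 * (w x)\<^sup>2 + r x * q x * ((w x)\<^sup>2 - (p x)\<^sup>2)) / w x ^ 3"
        using w_pos[of x] by (simp add: field_simps power2_eq_square power3_eq_cube)
      also have "\<dots> = ((p x)\<^sup>2 * (w x)\<^sup>2 + r x * q x) / w x ^ 3"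
        by (simp add: w_sq)
      also have "\<dots> = ((1 + (p x)\<^sup>2) * (w x)\<^sup>2 - H * r x * w x ^ 3) / w x ^ 3"
        using pos[of x] by (simp add: q_eq algebra_simps)
      also have "\<dots> = w x - H * r x"
        unfolding w_sq[symmetric] using w_pos[of x]
        by (simp add: field_simps power2_eq_square power3_eq_cube)
      finally show ?thesis .
    qed
    ultimately have rp: "((\<lambda>x. r x * p x / w x) has_real_derivative w x - H * r x) (at x)"
      by simp
    \<comment> \<open>The first integral trades the term linear in \<open>r\<close> for one in
      \<open>r\<^sup>2\<close>, which makes the oscillator equation linear.\<close>
    have "2 * H * r x = w x * ((H * r x)\<^sup>2 + 1 - B\<^sup>2)"
      using first_integral[of x] w_pos[of x] by (simp add: field_simps)
    then have "2 * H * (w x - H * r x) + 2 * B * (sin (H * S x) * (H * w x)) = - (H * w x * v x)"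
      unfolding v_def by algebra
    moreover have "((\<lambda>x. cos (H * S x)) has_real_derivative - (sin (H * S x) * (H * w x))) (at x)"
      by (auto intro!: derivative_eq_intros S)
    note DERIV_diff[OF DERIV_cmult[OF rp, of "2 * H"] DERIV_cmult[OF this, of "2 * B"]]
    ultimately show ?thesis unfolding z_def by simp
  qed
  have "((\<lambda>x. (v x)\<^sup>2 + (z x)\<^sup>2) has_real_derivative 0) (at x)" for x
    by (auto intro!: derivative_eq_intros v' z')
  then have "(v x)\<^sup>2 + (z x)\<^sup>2 = (v x0)\<^sup>2 + (z x0)\<^sup>2" for x
    using DERIV_isconst_all[of "\<lambda>x. (v x)\<^sup>2 + (z x)\<^sup>2"] by blast
  moreover have "v x0 = 0" "z x0 = 0"
    by (auto simp: v_def z_def HS_x0 p_x0 B_def power2_eq_square algebra_simps)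
  ultimately have "v x = 0" for x
    by (simp add: sum_power2_eq_zero_iff)
  then have rS: "(H * r x)\<^sup>2 = 1 + B\<^sup>2 + 2 * B * sin (H * S x)" for x
    by (simp add: v_def algebra_simps)
  have sqrt_rS: "sqrt (1 + B\<^sup>2 + 2 * B * sin (H * S x)) = H * r x" for x
    using pos[of x] H_pos unfolding rS[symmetric] by simp

  have "surj S" using surj_of_deriv_ge_one S w_ge by blast
  define f where "f t = (1 + B * sin (H * t)) / sqrt (1 + B\<^sup>2 + 2 * B * sin (H * t))" for t
  \<comment> \<open>Every \<open>t\<close> is some \<open>S x\<close>, where the root is
    \<open>H * r x\<close>.\<close>
  have "sqrt (1 + B\<^sup>2 + 2 * B * sin (H * t)) \<noteq> 0" for t
  proof -
    obtain x where "t = S x" using \<open>surj S\<close> by (metis surjD)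
    then show ?thesis using sqrt_rS[of x] pos[of x] H_pos by simp
  qed
  then have "continuous_on UNIV f"
    unfolding f_def by (intro continuous_intros) auto
  then have I: "((\<lambda>u. LBINT t=ereal (pi / (2 * H))..ereal u. f t) has_real_derivative f s) (at s)"
    for s by (rule interval_integral_has_real_derivative)
  \<comment> \<open>By \<open>rS\<close>, \<open>1 + B * sin (H * S x)\<close> is half of
    \<open>(H * r x)\<^sup>2 + 1 - B\<^sup>2\<close>, so the first integral gives
    \<open>f (S x) = 1 / w x\<close>. Hence the abscissa of the curve at \<open>S x\<close> grows at
    unit rate in \<open>x\<close>.\<close>
  have fS: "f (S x) * w x = 1" for x
  proof -
    have "f (S x) = ((H * r x)\<^sup>2 + 1 - B\<^sup>2) / (2 * (H * r x))"
      unfolding f_def sqrt_rS rS using pos[of x] H_pos by (simp add: field_simps)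
    then show ?thesis
      using pos[of x] H_pos w_pos[of x] by (simp add: first_integral[symmetric])
  qed
  have "((\<lambda>x. (LBINT t=ereal (pi / (2 * H))..ereal (S x). f t) - x) has_real_derivative 0) (at x)"
    for x
    by (auto intro!: derivative_eq_intros DERIV_chain2[OF I S] simp: fS)
  then have "(LBINT t=ereal (pi / (2 * H))..ereal (S x). f t) - x
      = (LBINT t=ereal (pi / (2 * H))..ereal (S x0). f t) - x0" for x
    using DERIV_isconst_all[of "\<lambda>x. (LBINT t=ereal (pi / (2 * H))..ereal (S x). f t) - x"] by blast
  moreover have "S x0 = pi / (2 * H)" by (simp add: S_def)
  ultimately have xS: "(LBINT t=ereal (pi / (2 * H))..ereal (S x). f t) = x - x0" for x
    by (simp add: algebra_simps)
  have param: "delaunay_param H B (S x) = (x + - x0, r x)" for x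
    using xS[of x] H_pos by (simp add: delaunay_param_def f_def sqrt_rS)
  have "delaunay_curve H B = range (\<lambda>x. delaunay_param H B (S x))"
    unfolding delaunay_curve_def using \<open>surj S\<close> by (metis image_image)
  also have "\<dots> = translate_x (- x0) (graph_of r)"
    unfolding param translate_x_def graph_of_def by auto
  finally have curve: "translate_x (- x0) (graph_of r) = delaunay_curve H B" by simp

  have "B = 0 \<longleftrightarrow> (\<forall>x. r x = 1 / H)"
  proof
    assume "B = 0"
    then have "H * r x = 1" for x using sqrt_rS[of x] by simp
    then show "\<forall>x. r x = 1 / H" using H_pos by (simp add: field_simps)
  next
    assume "\<forall>x. r x = 1 / H"
    then show "B = 0" using H_pos by (simp add: B_def)
  qed
  with H_pos B_lt curve show ?thesis by (metis abs_ge_zero)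
qed

end
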